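(* Let $X$ be a finite topological $T_0$-space. If $\varphi:\mathbb{R}\times X\rightarrow X$ is a flow, then $\varphi$ is trivial.
   Context: A flow on a topological space $X$ is a continuous map $\varphi:\mathbb{R}\times X\to X$ (usual topology on $\mathbb{R}$, product topology on the domain) such that $\varphi(0,x)=x$ for all $x\in X$ and $\varphi(s,\varphi(t,x))=\varphi(s+t,x)$ for all $x\in X$, $s,t\in\mathbb{R}$. It is trivial if $\varphi(t,\cdot)$ is the identity map of $X$ for every $t\in\mathbb{R}$. *)

theory Defs
  imports "HOL-Analysis.Analysis"
begin

text \<open>
  Spaces are abstract topologies with an explicit carrier \<^term>\<open>topspace X\<close>. The values of a flow
  outside \<^term>\<open>UNIV \<times> topspace X\<close> are unspecified; continuity yields that it maps this set into
  \<^term>\<open>topspace X\<close>.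
\<close>

definition is_flow :: "'a topology \<Rightarrow> (real \<times> 'a \<Rightarrow> 'a) \<Rightarrow> bool" where
  "is_flow X \<phi> \<longleftrightarrow>
     continuous_map (prod_topology euclideanreal X) X \<phi> \<and>
     (\<forall>x\<in>topspace X. \<phi> (0, x) = x) \<and>
     (\<forall>x\<in>topspace X. \<forall>s t. \<phi> (s, \<phi> (t, x)) = \<phi> (s + t, x))"

definition trivial_flow :: "'a topology \<Rightarrow> (real \<times> 'a \<Rightarrow> 'a) \<Rightarrow> bool" where
  "trivial_flow X \<phi> \<longleftrightarrow> (\<forall>t. \<forall>x\<in>topspace X. \<phi> (t, x) = x)"

end

theory Submission
  imports Defs
begin

text \<open>
  A flow is an action of the divisible group of real numbers on a finite set, and such an action is
  trivial: by the pigeonhole principle every point is a periodic point of the time-\<open>s\<close> map with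
  period at most \<open>n = card (topspace X)\<close>, hence it is fixed by the time-\<open>n! * s\<close> map; now take
  \<open>s = t / n!\<close>.
\<close>

lemma is_flow_zero: "is_flow X \<phi> \<Longrightarrow> x \<in> topspace X \<Longrightarrow> \<phi> (0, x) = x"
  by (simp add: is_flow_def)

lemma is_flow_add:
  "is_flow X \<phi> \<Longrightarrow> x \<in> topspace X \<Longrightarrow> \<phi> (s, \<phi> (t, x)) = \<phi> (s + t, x)"
  by (simp add: is_flow_def)

lemma is_flow_in_topspace:
  assumes "is_flow X \<phi>" "x \<in> topspace X"
  shows "\<phi> (t, x) \<in> topspace X"
proof -
  have "\<phi> \<in> topspace (prod_topology euclideanreal X) \<rightarrow> topspace X"
    using assms(1) continuous_map_funspace unfolding is_flow_def by blast
  then show ?thesis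
    using assms(2) by auto
qed

lemma is_flow_fixed_mult:
  assumes "is_flow X \<phi>" "x \<in> topspace X" "\<phi> (s, x) = x"
  shows "\<phi> (of_nat m * s, x) = x"
proof (induction m)
  case 0
  show ?case
    using is_flow_zero[OF assms(1,2)] by simp
next
  case (Suc m)
  then show ?case
    using is_flow_add[OF assms(1,2), of "of_nat m * s" s] assms(3) by (simp add: algebra_simps)
qed

lemma is_flow_finite_period:
  assumes "finite (topspace X)" "is_flow X \<phi>" "x \<in> topspace X"
  obtains d where "0 < d" "d \<le> card (topspace X)" "\<phi> (of_nat d * s, x) = x"
proof -
  let ?n = "card (topspace X)" and ?g = "\<lambda>k::nat. \<phi> (of_nat k * s, x)"
  \<comment> \<open>\<open>{..?n}\<close> includes 0, so it has \<open>?n + 1\<close> indices, one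
    more than the carrier has points.\<close>
  have "card (?g ` {..?n}) \<le> ?n"
    using assms by (intro card_mono) (auto intro: is_flow_in_topspace)
  then have "\<not> inj_on ?g {..?n}"
    by (intro pigeonhole) simp
  then obtain i j where ij: "i < j" "j \<le> ?n" "?g i = ?g j"
    using linorder_inj_onI'[of "{..?n}" ?g] by auto
  \<comment> \<open>Flowing back for time \<open>i * s\<close> turns the coincidence into a return
    to \<open>x\<close> itself; negative times rule out a preperiodic tail.\<close>
  have "\<phi> (of_nat (j - i) * s, x) = \<phi> (- (of_nat i * s), ?g j)"
    using ij(1) by (simp add: is_flow_add[OF assms(2,3)] algebra_simps)
  also have "\<dots> = \<phi> (- (of_nat i * s), ?g i)"
    by (simp add: ij(3))
  also have "\<dots> = x"
    by (simp add: is_flow_add[OF assms(2,3)] is_flow_zero[OF assms(2,3)])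
  finally show thesis
    using ij by (intro that[of "j - i"]) auto
qed

theorem corollary3p9:
  fixes X :: "'a topology" and \<phi> :: "real \<times> 'a \<Rightarrow> 'a"
  assumes "finite (topspace X)"
    and "t0_space X"
    and "is_flow X \<phi>"
  shows "trivial_flow X \<phi>"
  unfolding trivial_flow_def
proof (intro allI ballI)
  fix t x
  assume x: "x \<in> topspace X"
  \<comment> \<open>The period \<open>d\<close> may depend on the time step \<open>t / N\<close>, so
    \<open>N\<close> is fixed first, as a multiple of every possible period.\<close>
  define N :: nat where "N = fact (card (topspace X))"
  obtain d where d: "0 < d" "d \<le> card (topspace X)" "\<phi> (of_nat d * (t / of_nat N), x) = x"
    using is_flow_finite_period[OF assms(1,3) x] .
  have "d dvd N"
    unfolding N_def using d by (intro dvd_fact) auto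
  then obtain m where m: "N = d * m"
    by (rule dvdE)
  have "N \<noteq> 0"
    by (simp add: N_def)
  \<comment> \<open>\<open>m\<close> periods, each lasting \<open>d * (t / N)\<close>, add up to
    exactly \<open>t\<close>.\<close>
  then have "of_nat m * (of_nat d * (t / of_nat N)) = t"
    by (simp add: m)
  then show "\<phi> (t, x) = x"
    using is_flow_fixed_mult[OF assms(3) x d(3), of m] by simp
qed

end
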